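(* Let $N=\{1,\ldots,n\}$ and let $C \subset \mathbb{R}^n$ be a compact convex set. The following statements are equivalent: (1) $C$ has a least weakly absolutely $(a,b)$-majorized element for each $a \in \mathbb{R}^n_{>0}$ and $b \in \mathbb{R}^n$; (2) $C$ has a least weakly absolutely $(1,b)$-majorized element for each $b \in \mathbb{R}^n$; (3) for each $b \in \mathbb{R}^n$, there exists $x^* \in C$ that is an optimal solution to $\min_{x \in C} \Phi(x+b)$ for any choice of monotonically even continuous Schur-convex function $\Phi:\mathbb{R}^n\to\mathbb{R}$; (4) for each permutation $\pi$ of $N$ and sign vector $s \in \{-1,1\}^n$ there exists $x^* \in C$ such that for all $x \in C$ we have $\sum_{i=1}^k s_{\pi(i)} x^*_{\pi(i)} \geq \sum_{i=1}^k s_{\pi(i)} x_{\pi(i)}$ for all $k \in N$; (5) the function $h(X,Y) := \max_{x \in C} (x(X) - x(Y))$, $(X,Y)\in 3^N$, is bisubmodular and $C = \tilde{B}(h)$.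
   Context: Notation: $x(A) := \sum_{i\in A} x_i$ for $x\in\mathbb{R}^n$, $A\subseteq N$; in "$(1,b)$", $1$ is the all-ones vector. $3^N$ is the set of ordered pairs $(S,T)$ of disjoint subsets of $N$. Weak absolute $(a,b)$-majorization: for $a\in\mathbb{R}^n_{>0}$, $b\in\mathbb{R}^n$, $x$ is weakly absolutely $(a,b)$-majorized by $y$ if $\sum_{i\in N} a_i\phi\left(\frac{x_i+b_i}{a_i}\right)\le \sum_{i\in N} a_i\phi\left(\frac{y_i+b_i}{a_i}\right)$ for all even continuous convex functions $\phi:\mathbb{R}\to\mathbb{R}$. A vector $x\in C$ is a least weakly absolutely $(a,b)$-majorized element of $C$ if $x$ is weakly absolutely $(a,b)$-majorized by every $y\in C$. Schur-convexity: let $x^{\downarrow}$ denote the rearrangement of $x$ in non-increasing order; $x\prec y$ if $\sum_{i=1}^k x^{\downarrow}_i\le\sum_{i=1}^k y^{\downarrow}_i$ for all $k\in N$ and $x(N)=y(N)$. $\Phi:\mathbb{R}^n\to\mathbb{R}$ is Schur-convex if $x\prec y$ implies $\Phi(x)\le\Phi(y)$. A Schur-convex function $\Phi$ is monotonically even if for every $i\in N$ and $x\in\mathbb{R}^n$: $\Phi$ is unchanged when $x_i$ is replaced by $-x_i$; if $x_i\le 0$ and $\epsilon>0$, replacing $x_i$ by $x_i-\epsilon$ does not decrease $\Phi$; and if $x_i\ge0$ and $\epsilon>0$, replacing $x_i$ by $x_i+\epsilon$ does not decrease $\Phi$. Bisubmodularity: $h:3^N\to\mathbb{R}$ with $h(\emptyset,\emptyset)=0$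 is bisubmodular if for all $(S_1,T_1),(S_2,T_2)\in 3^N$, $h(S_1,T_1)+h(S_2,T_2)\ge h\big((S_1\cup S_2)\setminus(T_1\cup T_2),(T_1\cup T_2)\setminus(S_1\cup S_2)\big)+h(S_1\cap S_2,T_1\cap T_2)$. The bisubmodular polyhedron defined by $h$ is $\tilde B(h):=\{x\in\mathbb{R}^n: x(S)-x(T)\le h(S,T)\ \forall (S,T)\in 3^N\}$. *)

theory Defs
  imports "HOL-Analysis.Analysis" "HOL-Library.Multiset"
begin

text \<open>The ground set \<open>N\<close> with \<open>n\<close> elements is the index type \<open>'n\<close>, with \<open>n = CARD('n)\<close>.\<close>

definition vsum :: "real ^ 'n::finite \<Rightarrow> 'n set \<Rightarrow> real" where
  "vsum x A = (\<Sum>i\<in>A. x $ i)"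

definition weakly_abs_majorized ::
    "real ^ 'n::finite \<Rightarrow> real ^ 'n \<Rightarrow> real ^ 'n \<Rightarrow> real ^ 'n \<Rightarrow> bool" where
  "weakly_abs_majorized a b x y \<longleftrightarrow>
    (\<forall>\<phi> :: real \<Rightarrow> real.
       (\<forall>t. \<phi> (- t) = \<phi> t) \<and> continuous_on UNIV \<phi> \<and> convex_on UNIV \<phi> \<longrightarrow>
       (\<Sum>i\<in>UNIV. a $ i * \<phi> ((x $ i + b $ i) / a $ i))
         \<le> (\<Sum>i\<in>UNIV. a $ i * \<phi> ((y $ i + b $ i) / a $ i)))"

definition least_weakly_abs_majorized ::
    "real ^ 'n::finite \<Rightarrow> real ^ 'n \<Rightarrow> (real ^ 'n) set \<Rightarrow> real ^ 'n \<Rightarrow> bool" where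
  "least_weakly_abs_majorized a b C x \<longleftrightarrow>
    x \<in> C \<and> (\<forall>y\<in>C. weakly_abs_majorized a b x y)"

text \<open>The non-increasing rearrangement as a list, indexed from \<open>0\<close>.\<close>

definition decr_rearrangement :: "real ^ 'n::finite \<Rightarrow> real list" where
  "decr_rearrangement x =
    rev (sorted_list_of_multiset (image_mset (\<lambda>i. x $ i) (mset_set UNIV)))"

definition majorized :: "real ^ 'n::finite \<Rightarrow> real ^ 'n \<Rightarrow> bool" where
  "majorized x y \<longleftrightarrow>
    (\<forall>k\<in>{1..CARD('n)}. (\<Sum>i<k. decr_rearrangement x ! i) \<le> (\<Sum>i<k. decr_rearrangement y ! i))
    \<and> vsum x UNIV = vsum y UNIV"

definition schur_convex :: "(real ^ 'n::finite \<Rightarrow> real) \<Rightarrow> bool" where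
  "schur_convex \<Phi> \<longleftrightarrow> (\<forall>x y. majorized x y \<longrightarrow> \<Phi> x \<le> \<Phi> y)"

definition replace_entry :: "real ^ 'n::finite \<Rightarrow> 'n \<Rightarrow> real \<Rightarrow> real ^ 'n" where
  "replace_entry x i t = (\<chi> j. if j = i then t else x $ j)"

definition monotonically_even :: "(real ^ 'n::finite \<Rightarrow> real) \<Rightarrow> bool" where
  "monotonically_even \<Phi> \<longleftrightarrow>
    (\<forall>i x. \<Phi> (replace_entry x i (- (x $ i))) = \<Phi> x
       \<and> (\<forall>\<epsilon>>0. x $ i \<le> 0 \<longrightarrow> \<Phi> x \<le> \<Phi> (replace_entry x i (x $ i - \<epsilon>)))
       \<and> (\<forall>\<epsilon>>0. x $ i \<ge> 0 \<longrightarrow> \<Phi> x \<le> \<Phi> (replace_entry x i (x $ i + \<epsilon>))))"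

definition disjoint_pairs :: "('n set \<times> 'n set) set" where
  "disjoint_pairs = {(S, T). S \<inter> T = {}}"

text \<open>Functions on disjoint pairs are represented by total functions on pairs; the two
  definitions below inspect only their values on \<^const>\<open>disjoint_pairs\<close>.\<close>

definition bisubmodular :: "('n set \<times> 'n set \<Rightarrow> real) \<Rightarrow> bool" where
  "bisubmodular h \<longleftrightarrow>
    h ({}, {}) = 0 \<and>
    (\<forall>(S1, T1)\<in>disjoint_pairs. \<forall>(S2, T2)\<in>disjoint_pairs.
       h (S1, T1) + h (S2, T2)
         \<ge> h ((S1 \<union> S2) - (T1 \<union> T2), (T1 \<union> T2) - (S1 \<union> S2)) + h (S1 \<inter> S2, T1 \<inter> T2))"

definition bisubmodular_polyhedron ::
    "('n::finite set \<times> 'n set \<Rightarrow> real) \<Rightarrow> (real ^ 'n) set" where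
  "bisubmodular_polyhedron h =
    {x. \<forall>(S, T)\<in>disjoint_pairs. vsum x S - vsum x T \<le> h (S, T)}"

text \<open>The supremum below is a maximum for nonempty compact \<open>C\<close>, as the lemma shows.
  For \<open>C = {}\<close> it is an unspecified constant.\<close>

definition max_diff :: "(real ^ 'n::finite) set \<Rightarrow> 'n set \<times> 'n set \<Rightarrow> real" where
  "max_diff C = (\<lambda>(X, Y). SUP x\<in>C. vsum x X - vsum x Y)"

lemma max_diff_is_max:
  fixes C :: "(real ^ 'n::finite) set"
  assumes "compact C" "C \<noteq> {}"
  shows "\<exists>x\<in>C. max_diff C (X, Y) = vsum x X - vsum x Y
           \<and> (\<forall>y\<in>C. vsum y X - vsum y Y \<le> vsum x X - vsum x Y)"
proof -
  have "continuous_on C (\<lambda>x. vsum x X - vsum x Y)"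
    unfolding vsum_def by (intro continuous_intros)
  from continuous_attains_sup[OF assms this]
  obtain x where x: "x \<in> C" "\<forall>y\<in>C. vsum y X - vsum y Y \<le> vsum x X - vsum x Y"
    by blast
  then have "(SUP x\<in>C. vsum x X - vsum x Y) = vsum x X - vsum x Y"
    by (intro cSup_eq_maximum) auto
  with x show ?thesis
    by (auto simp: max_diff_def)
qed

definition all_equivalent :: "bool list \<Rightarrow> bool" where
  "all_equivalent Ps \<longleftrightarrow> (\<forall>P\<in>set Ps. \<forall>Q\<in>set Ps. P \<longleftrightarrow> Q)"

end

theory Submission
  imports Defs
begin

text \<open>The hub is (4). A linear functional \<open>c\<close>, Abel-summed along an enumeration that decreases
  \<open>\<bar>c\<^sub>i\<bar>\<close>, is a nonnegative combination of signed prefix sums. Under (4), separation then gives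
  (5), and a minimizer of the strictly convex function \<open>\<Sum> (x\<^sub>i + b\<^sub>i)\<^sup>2 / a\<^sub>i\<close>, which is optimal for
  its own gradient, stays optimal for the subgradients of every other even convex \<open>\<phi>\<close>, because
  these order the coordinates in the same way; this is (1). The greedy algorithm leads from (5)
  back to (4). Conversely (2) or (3), tested on the functions \<open>\<Sum> max (\<bar>x\<^sub>i + b\<^sub>i\<bar> - c) 0\<close> with
  widely separated \<open>b\<^sub>i\<close>, gives (4). These functions also express weak majorization of absolute
  values, whence (3).\<close>

section \<open>Preliminaries: Abel summation, sorted enumerations, modularity of signed sums\<close>

lemma abel_summation:
  fixes c f :: "nat \<Rightarrow> real"
  shows "(\<Sum>k=1..n. c k * f k)
    = (\<Sum>k=1..n. (c k - c (Suc k)) * (\<Sum>i=1..k. f i)) + c (Suc n) * (\<Sum>i=1..n. f i)"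
  by (induction n) (simp_all add: algebra_simps)

lemma obtain_decreasing_enumeration:
  fixes f :: "'n::finite \<Rightarrow> real"
  obtains \<sigma> where "bij_betw \<sigma> {..<CARD('n)} UNIV"
    "\<And>i j. i \<le> j \<Longrightarrow> j < CARD('n) \<Longrightarrow> f (\<sigma> j) \<le> f (\<sigma> i)"
proof -
  obtain ys :: "'n list" where ys: "set ys = UNIV" "distinct ys"
    using finite_distinct_list[of "UNIV :: 'n set"] by auto
  define xs where "xs = sort_key (\<lambda>i. - f i) ys"
  have xs: "set xs = UNIV" "distinct xs" "sorted (map (\<lambda>i. - f i) xs)"
    using ys by (simp_all add: xs_def)
  then have len: "length xs = CARD('n)"
    by (metis distinct_card)
  show thesis
  proof
    show "bij_betw (\<lambda>i. xs ! i) {..<CARD('n)} UNIV"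
      using xs len by (intro bij_betw_nth) auto
    show "f (xs ! j) \<le> f (xs ! i)" if "i \<le> j" "j < CARD('n)" for i j
      using sorted_nth_mono[OF xs(3) that(1)] that len by simp
  qed
qed

lemma vsum_diff_as_sum:
  "vsum x S - vsum x T
    = (\<Sum>i\<in>UNIV. ((if i \<in> S then 1 else 0) - (if i \<in> T then 1 else 0)) * x $ i)"
proof -
  have *: "vsum x A = (\<Sum>i\<in>UNIV. (if i \<in> A then 1 else 0) * x $ i)" for A
    unfolding vsum_def by (rule sum.mono_neutral_cong_left) auto
  show ?thesis
    unfolding * by (simp add: sum_subtractf left_diff_distrib)
qed

text \<open>Coordinatewise, an index with the same sign in both pairs counts twice on each side,
  opposite signs cancel, and an index in only one pair survives once. So a vector satisfies the
  bisubmodular inequality with equality, which is the lever in both directions between (4) and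
  (5).\<close>

lemma vsum_modular:
  assumes "S1 \<inter> T1 = {}" "S2 \<inter> T2 = {}"
  shows "(vsum x S1 - vsum x T1) + (vsum x S2 - vsum x T2)
    = (vsum x ((S1 \<union> S2) - (T1 \<union> T2)) - vsum x ((T1 \<union> T2) - (S1 \<union> S2)))
      + (vsum x (S1 \<inter> S2) - vsum x (T1 \<inter> T2))"
proof -
  have "i \<in> S1 \<Longrightarrow> i \<notin> T1" "i \<in> S2 \<Longrightarrow> i \<notin> T2" for i
    using assms by auto
  then show ?thesis
    unfolding vsum_diff_as_sum sum.distrib[symmetric] distrib_right[symmetric]
    by (intro sum.cong refl arg_cong2[where f = "(*)"]) simp
qed

subsection \<open>Prefix sums along a signed enumeration\<close>

definition signed_enumeration :: "(nat \<Rightarrow> 'n::finite) \<Rightarrow> real ^ 'n \<Rightarrow> bool" where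
  "signed_enumeration \<pi> s \<longleftrightarrow> bij_betw \<pi> {1..CARD('n)} UNIV \<and> (\<forall>i. s $ i \<in> {-1, 1})"

definition prefix_sum :: "(nat \<Rightarrow> 'n::finite) \<Rightarrow> real ^ 'n \<Rightarrow> nat \<Rightarrow> real ^ 'n \<Rightarrow> real" where
  "prefix_sum \<pi> s k x = (\<Sum>i=1..k. s $ \<pi> i * x $ \<pi> i)"

definition simultaneously_maximizing :: "(real ^ 'n::finite) set \<Rightarrow> bool" where
  "simultaneously_maximizing C \<longleftrightarrow> (\<forall>\<pi> s. signed_enumeration \<pi> s \<longrightarrow>
    (\<exists>x'\<in>C. \<forall>x\<in>C. \<forall>k\<in>{1..CARD('n)}. prefix_sum \<pi> s k x \<le> prefix_sum \<pi> s k x'))"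

text \<open>Splitting a prefix by sign gives a disjoint pair, so that a signed prefix sum becomes
  one of the functionals that \<open>max_diff\<close> maximizes.\<close>

definition positives :: "(nat \<Rightarrow> 'n::finite) \<Rightarrow> real ^ 'n \<Rightarrow> nat \<Rightarrow> 'n set" where
  "positives \<pi> s k = {j \<in> \<pi> ` {1..k}. s $ j = 1}"

definition negatives :: "(nat \<Rightarrow> 'n::finite) \<Rightarrow> real ^ 'n \<Rightarrow> nat \<Rightarrow> 'n set" where
  "negatives \<pi> s k = {j \<in> \<pi> ` {1..k}. s $ j = -1}"

lemma positives_negatives_disjoint: "positives \<pi> s k \<inter> negatives \<pi> s l = {}"
  by (auto simp: positives_def negatives_def)

lemma prefix_sum_eq_vsum_diff:
  fixes \<pi> :: "nat \<Rightarrow> 'n::finite"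
  assumes "signed_enumeration \<pi> s" "k \<le> CARD('n)"
  shows "prefix_sum \<pi> s k x = vsum x (positives \<pi> s k) - vsum x (negatives \<pi> s k)"
proof -
  have inj: "inj_on \<pi> {1..k}"
    using assms by (auto simp: signed_enumeration_def bij_betw_def intro: inj_on_subset)
  have s: "s $ i = 1 \<or> s $ i = -1" for i
    using assms by (auto simp: signed_enumeration_def)
  have "prefix_sum \<pi> s k x = (\<Sum>j\<in>\<pi> ` {1..k}. s $ j * x $ j)"
    unfolding prefix_sum_def sum.reindex[OF inj] by simp
  also have "\<dots> = vsum x (positives \<pi> s k) - vsum x (negatives \<pi> s k)"
    unfolding vsum_diff_as_sum
  proof (rule sum.mono_neutral_cong_left)
    show "s $ j * x $ j = ((if j \<in> positives \<pi> s k then 1 else 0)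
      - (if j \<in> negatives \<pi> s k then 1 else 0)) * x $ j" if "j \<in> \<pi> ` {1..k}" for j
      using s[of j] that by (auto simp: positives_def negatives_def)
  qed (auto simp: positives_def negatives_def)
  finally show ?thesis .
qed

text \<open>Truncating the coefficients to zero after \<open>CARD('n)\<close> absorbs the boundary term of the
  Abel summation.\<close>

definition coefficient_drop :: "(nat \<Rightarrow> 'n::finite) \<Rightarrow> ('n \<Rightarrow> real) \<Rightarrow> nat \<Rightarrow> real" where
  "coefficient_drop \<pi> g k = g (\<pi> k) - (if k < CARD('n) then g (\<pi> (Suc k)) else 0)"

text \<open>When all drops are nonnegative, comparing the functional at two points reduces to
  comparing their prefix sums.\<close>

lemma linear_functional_as_prefix_sums:
  fixes \<pi> :: "nat \<Rightarrow> 'n::finite"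
  assumes "signed_enumeration \<pi> s"
  shows "(\<Sum>i\<in>UNIV. g i * (s $ i * x $ i))
    = (\<Sum>k=1..CARD('n). coefficient_drop \<pi> g k * prefix_sum \<pi> s k x)"
proof -
  have bij: "bij_betw \<pi> {1..CARD('n)} UNIV"
    using assms by (simp add: signed_enumeration_def)
  define c where "c = (\<lambda>k. if k \<le> CARD('n) then g (\<pi> k) else 0)"
  have "(\<Sum>i\<in>UNIV. g i * (s $ i * x $ i))
      = (\<Sum>k=1..CARD('n). g (\<pi> k) * (s $ \<pi> k * x $ \<pi> k))"
    using sum.reindex_bij_betw[OF bij, of "\<lambda>i. g i * (s $ i * x $ i)"] by simp
  also have "\<dots> = (\<Sum>k=1..CARD('n). c k * (s $ \<pi> k * x $ \<pi> k))"
    by (intro sum.cong) (auto simp: c_def)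
  also have "\<dots> = (\<Sum>k=1..CARD('n). (c k - c (Suc k)) * prefix_sum \<pi> s k x)"
    by (subst abel_summation) (simp add: prefix_sum_def c_def)
  also have "\<dots> = (\<Sum>k=1..CARD('n). coefficient_drop \<pi> g k * prefix_sum \<pi> s k x)"
    by (intro sum.cong) (auto simp: c_def coefficient_drop_def)
  finally show ?thesis .
qed

text \<open>All weights that are weakly monotone in \<open>g\<close> share one enumeration; this is what makes a
  single point optimal for all convex functions at once.\<close>

lemma obtain_decreasing_signed_enumeration:
  fixes g :: "'n::finite \<Rightarrow> real" and s :: "real ^ 'n"
  assumes "\<And>i. s $ i \<in> {-1, 1}"
  obtains \<pi> where "signed_enumeration \<pi> s"
    "\<And>h k. k \<in> {1..CARD('n)} \<Longrightarrow> (\<And>i. h i \<ge> 0) \<Longrightarrow> (\<And>i j. g i \<le> g j \<Longrightarrow> h i \<le> h j)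
      \<Longrightarrow> coefficient_drop \<pi> h k \<ge> 0"
proof -
  obtain \<sigma> where \<sigma>: "bij_betw \<sigma> {..<CARD('n)} (UNIV :: 'n set)"
    "\<And>i j. i \<le> j \<Longrightarrow> j < CARD('n) \<Longrightarrow> g (\<sigma> j) \<le> g (\<sigma> i)"
    using obtain_decreasing_enumeration by blast
  have "bij_betw (\<lambda>k. k - 1) {1..CARD('n)} {..<CARD('n)}"
    by (rule bij_betwI[where g = Suc]) auto
  from bij_betw_trans[OF this \<sigma>(1)]
  have "signed_enumeration (\<lambda>k. \<sigma> (k - 1)) s"
    using assms by (auto simp: signed_enumeration_def comp_def)
  moreover have "coefficient_drop (\<lambda>k. \<sigma> (k - 1)) h k \<ge> 0"
    if "k \<in> {1..CARD('n)}" "\<And>i. h i \<ge> 0" "\<And>i j. g i \<le> g j \<Longrightarrow> h i \<le> h j" for h k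
    using \<sigma>(2)[of "k - 1" k] that by (auto simp: coefficient_drop_def)
  ultimately show thesis
    using that by blast
qed

subsection \<open>Simultaneous maximizers and bisubmodularity\<close>

text \<open>Compared under \<open>g\<close>, the point \<open>x0\<close> and a simultaneous
  maximizer must agree on every prefix sum at which \<open>g\<close> strictly drops. Since
  \<open>h\<close> is monotone in \<open>g\<close> and vanishes where \<open>g\<close> does,
  \<open>h\<close> drops only at those prefixes, so \<open>x0\<close> is as good for
  \<open>h\<close> as the simultaneous maximizer.\<close>

lemma maximizer_transfer:
  fixes C :: "(real ^ 'n::finite) set"
  assumes max: "simultaneously_maximizing C" and s: "\<And>i. s $ i \<in> {-1, 1}"
    and g: "\<And>i. g i \<ge> 0" and x0: "x0 \<in> C"
      "\<And>x. x \<in> C \<Longrightarrow> (\<Sum>i\<in>UNIV. g i * (s $ i * x $ i)) \<le> (\<Sum>i\<in>UNIV. g i * (s $ i * x0 $ i))"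
    and h: "\<And>i. h i \<ge> 0" "\<And>i j. g i \<le> g j \<Longrightarrow> h i \<le> h j" "\<And>i. g i = 0 \<Longrightarrow> h i = 0"
    and x: "x \<in> C"
  shows "(\<Sum>i\<in>UNIV. h i * (s $ i * x $ i)) \<le> (\<Sum>i\<in>UNIV. h i * (s $ i * x0 $ i))"
proof -
  obtain \<pi> where \<pi>: "signed_enumeration \<pi> s" and drop:
    "\<And>h k. k \<in> {1..CARD('n)} \<Longrightarrow> (\<And>i. h i \<ge> 0) \<Longrightarrow> (\<And>i j. g i \<le> g j \<Longrightarrow> h i \<le> h j)
      \<Longrightarrow> coefficient_drop \<pi> h k \<ge> 0"
    using obtain_decreasing_signed_enumeration[OF s, of g] by blast
  obtain x' where x': "x' \<in> C"
    "\<And>y k. y \<in> C \<Longrightarrow> k \<in> {1..CARD('n)} \<Longrightarrow> prefix_sum \<pi> s k y \<le> prefix_sum \<pi> s k x'"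
    using max \<pi> unfolding simultaneously_maximizing_def by blast
  let ?d = "\<lambda>k. coefficient_drop \<pi> g k * (prefix_sum \<pi> s k x' - prefix_sum \<pi> s k x0)"
  have nonneg: "?d k \<ge> 0" if "k \<in> {1..CARD('n)}" for k
    using drop[OF that, of g] g x'(2)[OF x0(1) that] by simp
  \<comment> \<open>Optimality of \<open>x0\<close> under \<open>g\<close> bounds the sum above by
    0, while optimality of \<open>x'\<close> on prefixes makes each term nonnegative; hence every
    term vanishes.\<close>
  have "(\<Sum>k=1..CARD('n). ?d k) \<le> 0"
    using x0(2)[OF x'(1)] unfolding linear_functional_as_prefix_sums[OF \<pi>]
    by (simp add: right_diff_distrib sum_subtractf)
  then have sum_zero: "(\<Sum>k=1..CARD('n). ?d k) = 0"
    using nonneg by (intro antisym sum_nonneg)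
  have zero: "?d k = 0" if "k \<in> {1..CARD('n)}" for k
    by (rule sum_nonneg_0[of "{1..CARD('n)}" ?d, OF finite_atLeastAtMost nonneg sum_zero that])
  have "coefficient_drop \<pi> h k * prefix_sum \<pi> s k x \<le> coefficient_drop \<pi> h k * prefix_sum \<pi> s k x0"
    if k: "k \<in> {1..CARD('n)}" for k
  proof (cases "coefficient_drop \<pi> g k = 0")
    case True
    \<comment> \<open>A zero drop means two equal consecutive weights, so monotonicity applies both
      ways; at the last position it means weight 0.\<close>
    then have "coefficient_drop \<pi> h k = 0"
      using h(2)[of "\<pi> k" "\<pi> (Suc k)"] h(2)[of "\<pi> (Suc k)" "\<pi> k"] h(3)[of "\<pi> k"]
      by (auto simp: coefficient_drop_def split: if_splits)
    then show ?thesis by simp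
  next
    case False
    then have "prefix_sum \<pi> s k x' = prefix_sum \<pi> s k x0"
      using zero[OF k] by simp
    then show ?thesis
      using x'(2)[OF x k] drop[OF k h(1,2)] by (simp add: mult_left_mono)
  qed
  then show ?thesis
    unfolding linear_functional_as_prefix_sums[OF \<pi>] by (intro sum_mono) auto
qed

section \<open>The support function on disjoint pairs\<close>

lemma bisubmodular_iff:
  "bisubmodular h \<longleftrightarrow> h ({}, {}) = 0 \<and>
    (\<forall>S1 T1 S2 T2. S1 \<inter> T1 = {} \<longrightarrow> S2 \<inter> T2 = {} \<longrightarrow>
      h ((S1 \<union> S2) - (T1 \<union> T2), (T1 \<union> T2) - (S1 \<union> S2)) + h (S1 \<inter> S2, T1 \<inter> T2)
        \<le> h (S1, T1) + h (S2, T2))"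
  unfolding bisubmodular_def disjoint_pairs_def Ball_def mem_Collect_eq split_paired_All prod.case
  by blast

lemma max_diff_upper:
  assumes "compact C" "x \<in> C"
  shows "vsum x X - vsum x Y \<le> max_diff C (X, Y)"
  using max_diff_is_max[of C X Y] assms by force

lemma max_diff_empty_pair: "C \<noteq> {} \<Longrightarrow> max_diff C ({}, {}) = 0"
  by (simp add: max_diff_def vsum_def)

lemma max_diff_eqI:
  assumes "compact C" "x \<in> C" "\<And>y. y \<in> C \<Longrightarrow> vsum y X - vsum y Y \<le> vsum x X - vsum x Y"
  shows "max_diff C (X, Y) = vsum x X - vsum x Y"
  using max_diff_is_max[of C X Y] assms max_diff_upper[OF assms(1,2), of X Y] by force

text \<open>Maximize the sum of the two functionals: its weight is 2 on the inner pair, 1 on the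
  rest of the outer pair and 0 elsewhere. Both indicator weights are monotone in it and vanish with
  it, so \<open>maximizer_transfer\<close> makes the same point optimal for each functional.\<close>

lemma chain_maximizer:
  fixes C :: "(real ^ 'n::finite) set"
  assumes C: "compact C" "C \<noteq> {}" and max: "simultaneously_maximizing C"
    and sub: "A \<subseteq> P" "B \<subseteq> Q" and disj: "P \<inter> Q = {}"
  obtains x where "x \<in> C" "max_diff C (A, B) = vsum x A - vsum x B"
    "max_diff C (P, Q) = vsum x P - vsum x Q"
proof -
  define s :: "real ^ 'n" where "s = (\<chi> i. if i \<in> Q then -1 else 1)"
  define u :: "'n set \<Rightarrow> 'n \<Rightarrow> real" where "u S i = (if i \<in> S then 1 else 0)" for S i
  define g where "g i = u (A \<union> B) i + u (P \<union> Q) i" for i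
  have s: "s $ i \<in> {-1, 1}" for i
    by (auto simp: s_def)
  have "continuous_on C (\<lambda>x. \<Sum>i\<in>UNIV. g i * (s $ i * x $ i))"
    by (intro continuous_intros)
  then obtain x where x: "x \<in> C" "\<And>y. y \<in> C \<Longrightarrow>
      (\<Sum>i\<in>UNIV. g i * (s $ i * y $ i)) \<le> (\<Sum>i\<in>UNIV. g i * (s $ i * x $ i))"
    using continuous_attains_sup[OF C] by blast
  have disj': "A \<inter> B = {}" "A \<inter> Q = {}" "B \<inter> P = {}"
    using sub disj by auto
  have eq: "vsum y A - vsum y B = (\<Sum>i\<in>UNIV. u (A \<union> B) i * (s $ i * y $ i))"
    "vsum y P - vsum y Q = (\<Sum>i\<in>UNIV. u (P \<union> Q) i * (s $ i * y $ i))" for y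
    unfolding vsum_diff_as_sum u_def s_def
    using disj sub disj' by (auto intro!: sum.cong)
  have u: "0 \<le> u S i" for S i
    by (simp add: u_def)
  have g: "0 \<le> g i" for i
    by (simp add: g_def u)
  have mono: "g i \<le> g j \<Longrightarrow> u (A \<union> B) i \<le> u (A \<union> B) j"
      "g i \<le> g j \<Longrightarrow> u (P \<union> Q) i \<le> u (P \<union> Q) j"
      "g i = 0 \<Longrightarrow> u (A \<union> B) i = 0" "g i = 0 \<Longrightarrow> u (P \<union> Q) i = 0" for i j
    using subsetD[OF sub(1), of i] subsetD[OF sub(1), of j]
      subsetD[OF sub(2), of i] subsetD[OF sub(2), of j]
    by (auto simp: g_def u_def split: if_splits)
  have le: "vsum y A - vsum y B \<le> vsum x A - vsum x B"
    "vsum y P - vsum y Q \<le> vsum x P - vsum x Q" if "y \<in> C" for y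
    unfolding eq
    by (rule maximizer_transfer[OF max s g x u mono(1,3) that], assumption+)
       (rule maximizer_transfer[OF max s g x u mono(2,4) that], assumption+)
  show thesis
    by (rule that[OF x(1) max_diff_eqI[OF C(1) x(1) le(1)] max_diff_eqI[OF C(1) x(1) le(2)]])
qed

lemma simultaneously_maximizing_nonempty:
  fixes C :: "(real ^ 'n::finite) set"
  assumes "simultaneously_maximizing C"
  shows "C \<noteq> {}"
proof -
  have "((\<chi> i. 1) :: real ^ 'n) $ i \<in> {-1, 1}" for i
    by simp
  from obtain_decreasing_signed_enumeration[OF this, of "\<lambda>_. 0"]
  obtain \<pi> where "signed_enumeration \<pi> ((\<chi> i. 1) :: real ^ 'n)" .
  with assms show ?thesis
    unfolding simultaneously_maximizing_def by blast
qed

text \<open>The intersection pair is nested in the reduced union pair, so one point attains both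
  maxima on the smaller side. At that point the modular identity and the upper bounds for the two
  original pairs finish the argument.\<close>

lemma bisubmodular_max_diff:
  fixes C :: "(real ^ 'n::finite) set"
  assumes C: "compact C" and max: "simultaneously_maximizing C"
  shows "bisubmodular (max_diff C)"
proof -
  have ne: "C \<noteq> {}"
    using simultaneously_maximizing_nonempty[OF max] .
  have "max_diff C ((S1 \<union> S2) - (T1 \<union> T2), (T1 \<union> T2) - (S1 \<union> S2))
      + max_diff C (S1 \<inter> S2, T1 \<inter> T2) \<le> max_diff C (S1, T1) + max_diff C (S2, T2)"
    if disj: "S1 \<inter> T1 = {}" "S2 \<inter> T2 = {}" for S1 T1 S2 T2
  proof -
    have "S1 \<inter> S2 \<subseteq> (S1 \<union> S2) - (T1 \<union> T2)" "T1 \<inter> T2 \<subseteq> (T1 \<union> T2) - (S1 \<union> S2)"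
      using disj by auto
    then obtain x where x: "x \<in> C"
      "max_diff C (S1 \<inter> S2, T1 \<inter> T2) = vsum x (S1 \<inter> S2) - vsum x (T1 \<inter> T2)"
      "max_diff C ((S1 \<union> S2) - (T1 \<union> T2), (T1 \<union> T2) - (S1 \<union> S2))
        = vsum x ((S1 \<union> S2) - (T1 \<union> T2)) - vsum x ((T1 \<union> T2) - (S1 \<union> S2))"
      using chain_maximizer[OF C ne max, of "S1 \<inter> S2" "(S1 \<union> S2) - (T1 \<union> T2)"
          "T1 \<inter> T2" "(T1 \<union> T2) - (S1 \<union> S2)"] by blast
    show ?thesis
      using max_diff_upper[OF C x(1), of S1 T1] max_diff_upper[OF C x(1), of S2 T2]
        vsum_modular[OF disj, of x] x(2,3) by linarith
  qed
  then show ?thesis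
    using max_diff_empty_pair[OF ne] unfolding bisubmodular_iff by blast
qed

text \<open>A hyperplane separating a point of the polyhedron from \<open>C\<close> has a normal
  that decomposes into signed prefix sums. Each of these is bounded on the polyhedron by its maximum
  over \<open>C\<close>, and one point of \<open>C\<close> attains all these maxima, contradicting
  separation.\<close>

lemma eq_bisubmodular_polyhedron:
  fixes C :: "(real ^ 'n::finite) set"
  assumes C: "compact C" "convex C" and max: "simultaneously_maximizing C"
  shows "C = bisubmodular_polyhedron (max_diff C)"
proof
  show "C \<subseteq> bisubmodular_polyhedron (max_diff C)"
    using max_diff_upper[OF C(1)] by (auto simp: bisubmodular_polyhedron_def)
  show "bisubmodular_polyhedron (max_diff C) \<subseteq> C"
  proof (rule subsetI, rule ccontr)
    fix z assume z: "z \<in> bisubmodular_polyhedron (max_diff C)" "z \<notin> C"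
    obtain c b where cb: "c \<bullet> z < b" "\<And>x. x \<in> C \<Longrightarrow> c \<bullet> x > b"
      using separating_hyperplane_closed_point[OF C(2) compact_imp_closed[OF C(1)] z(2)] by blast
    \<comment> \<open>The signs oppose \<open>c\<close> because \<open>z\<close> lies on the low
      side of the hyperplane: the functional to maximize is the negative of
      \<open>c\<close>.\<close>
    define s :: "real ^ 'n" where "s = (\<chi> i. if c $ i > 0 then -1 else 1)"
    have s: "s $ i \<in> {-1, 1}" for i
      by (auto simp: s_def)
    have inner: "- (c \<bullet> x) = (\<Sum>i\<in>UNIV. \<bar>c $ i\<bar> * (s $ i * x $ i))" for x
      unfolding inner_vec_def sum_negf[symmetric] by (intro sum.cong) (auto simp: s_def)
    obtain \<pi> where \<pi>: "signed_enumeration \<pi> s" and drop: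
      "\<And>h k. k \<in> {1..CARD('n)} \<Longrightarrow> (\<And>i. h i \<ge> 0) \<Longrightarrow>
        (\<And>i j. \<bar>c $ i\<bar> \<le> \<bar>c $ j\<bar> \<Longrightarrow> h i \<le> h j) \<Longrightarrow> coefficient_drop \<pi> h k \<ge> 0"
      using obtain_decreasing_signed_enumeration[OF s, of "\<lambda>i. \<bar>c $ i\<bar>"] by blast
    obtain x where x: "x \<in> C"
      "\<And>y k. y \<in> C \<Longrightarrow> k \<in> {1..CARD('n)} \<Longrightarrow> prefix_sum \<pi> s k y \<le> prefix_sum \<pi> s k x"
      using max \<pi> unfolding simultaneously_maximizing_def by blast
    have "prefix_sum \<pi> s k z \<le> prefix_sum \<pi> s k x" if k: "k \<in> {1..CARD('n)}" for k
    proof -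
      have F: "prefix_sum \<pi> s k y = vsum y (positives \<pi> s k) - vsum y (negatives \<pi> s k)" for y
        using prefix_sum_eq_vsum_diff[OF \<pi>] k by auto
      have "max_diff C (positives \<pi> s k, negatives \<pi> s k) = prefix_sum \<pi> s k x"
        unfolding F using x(2)[OF _ k] by (intro max_diff_eqI[OF C(1) x(1)]) (auto simp: F)
      moreover have "prefix_sum \<pi> s k z \<le> max_diff C (positives \<pi> s k, negatives \<pi> s k)"
        unfolding F using z(1) positives_negatives_disjoint[of \<pi> s k k]
        by (auto simp: bisubmodular_polyhedron_def disjoint_pairs_def)
      ultimately show ?thesis
        by simp
    qed
    then have "- (c \<bullet> z) \<le> - (c \<bullet> x)"
      unfolding inner linear_functional_as_prefix_sums[OF \<pi>]
      using drop[of _ "\<lambda>i. \<bar>c $ i\<bar>"] by (intro sum_mono mult_left_mono) auto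
    with cb(1) cb(2)[OF x(1)] show False
      by simp
  qed
qed

section \<open>The greedy algorithm\<close>

text \<open>The greedy point stays feasible: uncrossing with the prefix pairs settles the pairs whose
  signs agree with \<open>s\<close>, and uncrossing an arbitrary pair with the full pair
  reduces it to two pairs of that kind.\<close>

lemma greedy_point:
  fixes h :: "'n::finite set \<times> 'n set \<Rightarrow> real"
  assumes h: "bisubmodular h" and \<pi>: "signed_enumeration \<pi> s"
  obtains x where "x \<in> bisubmodular_polyhedron h"
    "\<And>k. k \<le> CARD('n) \<Longrightarrow> prefix_sum \<pi> s k x = h (positives \<pi> s k, negatives \<pi> s k)"
proof -
  define H where "H k = h (positives \<pi> s k, negatives \<pi> s k)" for k
  have bij: "bij_betw \<pi> {1..CARD('n)} UNIV" and s: "\<And>i. s $ i = 1 \<or> s $ i = -1"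
    using \<pi> by (auto simp: signed_enumeration_def)
  \<comment> \<open>Each coordinate is the signed marginal gain of \<open>h\<close> at its position,
    so the prefix sums telescope to \<open>H\<close>.\<close>
  define x :: "real ^ 'n" where "x = (\<chi> j. let k = the_inv_into {1..CARD('n)} \<pi> j in
    s $ j * (H k - H (k - 1)))"
  have x: "s $ \<pi> k * x $ \<pi> k = H k - H (k - 1)" if "k \<in> {1..CARD('n)}" for k
    using the_inv_into_f_f[OF bij_betw_imp_inj_on[OF bij] that] s[of "\<pi> k"]
    by (auto simp: x_def)
  have H0: "H 0 = 0"
    using h by (simp add: H_def positives_def negatives_def bisubmodular_iff)
  have prefix: "prefix_sum \<pi> s k x = H k" if "k \<le> CARD('n)" for k
    using that
  proof (induction k)
    case 0
    then show ?case by (simp add: prefix_sum_def H0)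
  next
    case (Suc k)
    then show ?case using x[of "Suc k"] by (simp add: prefix_sum_def)
  qed
  have Hx: "vsum x (positives \<pi> s k) - vsum x (negatives \<pi> s k)
      = h (positives \<pi> s k, negatives \<pi> s k)" if "k \<le> CARD('n)" for k
    using prefix[OF that] prefix_sum_eq_vsum_diff[OF \<pi> that] by (simp add: H_def)
  have bisub: "h ((S1 \<union> S2) - (T1 \<union> T2), (T1 \<union> T2) - (S1 \<union> S2)) + h (S1 \<inter> S2, T1 \<inter> T2)
      \<le> h (S1, T1) + h (S2, T2)" if "S1 \<inter> T1 = {}" "S2 \<inter> T2 = {}" for S1 T1 S2 T2
    using h that unfolding bisubmodular_iff by blast
  have consistent: "vsum x S - vsum x T \<le> h (S, T)"
    if "k \<le> CARD('n)" "S \<subseteq> positives \<pi> s k" "T \<subseteq> negatives \<pi> s k" for k S T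
    using that
  proof (induction k arbitrary: S T)
    case 0
    then show ?case
      using Hx[of 0] by (auto simp: positives_def negatives_def)
  next
    case (Suc k)
    let ?X = "positives \<pi> s k" and ?Y = "negatives \<pi> s k"
    let ?X' = "positives \<pi> s (Suc k)" and ?Y' = "negatives \<pi> s (Suc k)"
    have k: "Suc k \<in> {1..CARD('n)}"
      using Suc.prems by auto
    have step: "\<pi> ` {1..Suc k} = insert (\<pi> (Suc k)) (\<pi> ` {1..k})"
      by (auto simp: atLeastAtMostSuc_conv)
    show ?case
    proof (cases "\<pi> (Suc k) \<in> S \<union> T")
      case False
      then have "S \<subseteq> ?X" "T \<subseteq> ?Y"
        using Suc.prems step by (auto simp: positives_def negatives_def)
      then show ?thesis
        using Suc.IH Suc.prems(1) by simp
    next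
      case True
      \<comment> \<open>Since the new index lies in the pair, the reduced union with the prefix of
        length \<open>k\<close> is the whole prefix of length \<open>Suc k\<close>. Both prefix
        pairs are tight at \<open>x\<close>, so the bound for the intersection passes to
        \<open>(S, T)\<close>.\<close>
      have eqs: "(S \<union> ?X) - (T \<union> ?Y) = ?X'" "(T \<union> ?Y) - (S \<union> ?X) = ?Y'"
        using True Suc.prems(2,3) unfolding positives_def negatives_def step by auto
      have disj: "S \<inter> T = {}" "?X \<inter> ?Y = {}"
        using Suc.prems(2,3) positives_negatives_disjoint[of \<pi> s]
        by (blast, blast)
      have "vsum x (S \<inter> ?X) - vsum x (T \<inter> ?Y) \<le> h (S \<inter> ?X, T \<inter> ?Y)"
        using Suc.IH Suc.prems(1) by simp
      moreover note vsum_modular[OF disj, of x] bisub[OF disj] Hx[of k] Hx[of "Suc k"]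
      ultimately show ?thesis
        using k unfolding eqs by simp
    qed
  qed
  have "vsum x S - vsum x T \<le> h (S, T)" if disj: "S \<inter> T = {}" for S T
  proof -
    let ?n = "CARD('n)"
    let ?X = "positives \<pi> s ?n" and ?Y = "negatives \<pi> s ?n"
    have full: "?X \<inter> ?Y = {}" "?X \<union> ?Y = UNIV"
      using s bij by (auto simp: positives_def negatives_def bij_betw_def)
    have "vsum x (S \<inter> ?X) - vsum x (T \<inter> ?Y) \<le> h (S \<inter> ?X, T \<inter> ?Y)"
      by (rule consistent[of ?n]) auto
    \<comment> \<open>The full pair covers every index, so whatever survives the removal of
      \<open>?Y\<close> lies in \<open>?X\<close>, and vice versa.\<close>
    moreover have "vsum x ((S \<union> ?X) - (T \<union> ?Y)) - vsum x ((T \<union> ?Y) - (S \<union> ?X))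
        \<le> h ((S \<union> ?X) - (T \<union> ?Y), (T \<union> ?Y) - (S \<union> ?X))"
      using full by (intro consistent[of ?n]) auto
    moreover note vsum_modular[OF disj full(1), of x] bisub[OF disj full(1)] Hx[of ?n]
    ultimately show ?thesis
      by simp
  qed
  then have "x \<in> bisubmodular_polyhedron h"
    by (auto simp: bisubmodular_polyhedron_def disjoint_pairs_def)
  then show thesis
    by (rule that) (simp add: prefix H_def)
qed

text \<open>The greedy point attains the maximum for every prefix pair at once, and the polyhedral
  description places it in \<open>C\<close>. In particular, an empty \<open>C\<close> cannot satisfy
  (5).\<close>

lemma simultaneously_maximizing_if_bisubmodular:
  fixes C :: "(real ^ 'n::finite) set"
  assumes C: "compact C" and h: "bisubmodular (max_diff C)"
    and eq: "C = bisubmodular_polyhedron (max_diff C)"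
  shows "simultaneously_maximizing C"
  unfolding simultaneously_maximizing_def
proof (intro allI impI)
  fix \<pi> :: "nat \<Rightarrow> 'n" and s
  assume \<pi>: "signed_enumeration \<pi> s"
  obtain x' where x': "x' \<in> bisubmodular_polyhedron (max_diff C)"
    "\<And>k. k \<le> CARD('n) \<Longrightarrow>
      prefix_sum \<pi> s k x' = max_diff C (positives \<pi> s k, negatives \<pi> s k)"
    using greedy_point[OF h \<pi>] by blast
  have "prefix_sum \<pi> s k x \<le> prefix_sum \<pi> s k x'" if "x \<in> C" "k \<in> {1..CARD('n)}" for x k
  proof -
    have k: "k \<le> CARD('n)"
      using that by simp
    show ?thesis
      unfolding x'(2)[OF k] unfolding prefix_sum_eq_vsum_diff[OF \<pi> k]
      by (rule max_diff_upper[OF C that(1)])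
  qed
  moreover have "x' \<in> C"
    by (subst eq) (rule x'(1))
  ultimately show "\<exists>x'\<in>C. \<forall>x\<in>C. \<forall>k\<in>{1..CARD('n)}. prefix_sum \<pi> s k x \<le> prefix_sum \<pi> s k x'"
    by blast
qed

subsection \<open>Least weakly absolutely majorized elements\<close>

lemma obtain_subgradient:
  fixes \<phi> :: "real \<Rightarrow> real"
  assumes "convex_on UNIV \<phi>"
  obtains m where "\<And>t. \<phi> t \<ge> \<phi> p + m * (t - p)"
  using convex_le_Inf_differential[OF assms, of p] by auto

text \<open>Evenness lets the slope at \<open>q\<close> carry the sign of \<open>q\<close> and a
  magnitude depending only on its absolute value. The properties of \<open>G\<close> are what
  \<open>maximizer_transfer\<close> asks of new weights.\<close>

lemma obtain_even_subgradient:
  fixes \<phi> :: "real \<Rightarrow> real"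
  assumes convex: "convex_on UNIV \<phi>" and even: "\<And>t. \<phi> (- t) = \<phi> t"
  obtains G where "G 0 = 0" "\<And>p r. 0 \<le> p \<Longrightarrow> p \<le> r \<Longrightarrow> G p \<le> G r"
    "\<And>q t. \<phi> t \<ge> \<phi> q + sgn q * G \<bar>q\<bar> * (t - q)"
proof -
  have "\<forall>p. \<exists>m. \<forall>t. \<phi> t \<ge> \<phi> p + m * (t - p)"
    using obtain_subgradient[OF convex] by metis
  then obtain g where g: "\<And>p t. \<phi> t \<ge> \<phi> p + g p * (t - p)"
    by metis
  have zero: "\<phi> t \<ge> \<phi> 0" for t
    using g[of 0 t] g[of 0 "- t"] even[of t] by simp
  \<comment> \<open>Slope 0 at the origin is admissible because an even convex function is minimal
    there.\<close>
  define G where "G p = (if p = 0 then 0 else g p)" for p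
  have G: "\<phi> t \<ge> \<phi> p + G p * (t - p)" for p t
    using g[of p t] zero[of t] by (simp add: G_def)
  show thesis
  proof
    show "G 0 = 0"
      by (simp add: G_def)
    show "G p \<le> G r" if "0 \<le> p" "p \<le> r" for p r
    proof (cases "p = r")
      case False
      \<comment> \<open>Add the subgradient inequalities at \<open>p\<close> and
        \<open>r\<close>.\<close>
      have "(G r - G p) * (r - p) \<ge> 0"
        using G[of p r] G[of r p] by (simp add: algebra_simps)
      then show ?thesis
        using False that by (simp add: zero_le_mult_iff)
    qed simp
    show "\<phi> t \<ge> \<phi> q + sgn q * G \<bar>q\<bar> * (t - q)" for q t
    proof (cases "q < 0")
      case True
      then show ?thesis
        using G[of "- q" "- t"] even[of t] even[of q] by (simp add: algebra_simps)
    next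
      case False
      then show ?thesis
        using G[of q t] zero[of t] by (cases "q = 0") auto
    qed
  qed
qed

text \<open>This is the first-order condition for a minimizer of the weighted quadratic: moving
  towards \<open>y\<close> with a negative directional derivative would decrease it.\<close>

lemma least_quadratic_variational_inequality:
  fixes C :: "(real ^ 'n::finite) set"
  assumes C: "compact C" "convex C" "C \<noteq> {}" and a: "\<And>i. a $ i > 0"
  obtains x where "x \<in> C"
    "\<And>y. y \<in> C \<Longrightarrow> (\<Sum>i\<in>UNIV. (x $ i + b $ i) / a $ i * (y $ i - x $ i)) \<ge> 0"
proof -
  define f where "f x = (\<Sum>i\<in>UNIV. (x $ i + b $ i)\<^sup>2 / a $ i)" for x :: "real ^ 'n"
  have "continuous_on C f"
    unfolding f_def using a by (intro continuous_intros) (auto simp: less_imp_neq[symmetric])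
  then obtain x where x: "x \<in> C" "\<And>y. y \<in> C \<Longrightarrow> f x \<le> f y"
    using continuous_attains_inf[OF C(1,3)] by blast
  have "L \<ge> 0" if y: "y \<in> C" and L: "L = (\<Sum>i\<in>UNIV. (x $ i + b $ i) / a $ i * (y $ i - x $ i))"
    for y L
  proof (rule ccontr)
    assume neg: "\<not> L \<ge> 0"
    define Q where "Q = (\<Sum>i\<in>UNIV. (y $ i - x $ i)\<^sup>2 / a $ i)"
    have Q: "Q \<ge> 0"
      unfolding Q_def using a by (intro sum_nonneg) (simp add: less_imp_le)
    have expand: "f (x + t *\<^sub>R (y - x)) = f x + t * (2 * L) + t\<^sup>2 * Q" for t
      unfolding f_def L Q_def sum_distrib_left sum.distrib[symmetric]
    proof (rule sum.cong[OF refl])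
      fix i
      have "a $ i \<noteq> 0"
        using a[of i] by simp
      then show "((x + t *\<^sub>R (y - x)) $ i + b $ i)\<^sup>2 / a $ i = (x $ i + b $ i)\<^sup>2 / a $ i
          + t * (2 * ((x $ i + b $ i) / a $ i * (y $ i - x $ i))) + t\<^sup>2 * ((y $ i - x $ i)\<^sup>2 / a $ i)"
        by (simp add: field_simps power2_eq_square)
    qed
    have ineq: "2 * L + t * Q \<ge> 0" if t: "0 < t" "t \<le> 1" for t
    proof -
      have "x + t *\<^sub>R (y - x) = (1 - t) *\<^sub>R x + t *\<^sub>R y"
        by (simp add: algebra_simps)
      then have "x + t *\<^sub>R (y - x) \<in> C"
        using convexD_alt[OF C(2) x(1) y] t by simp
      from x(2)[OF this] have "t * (2 * L + t * Q) \<ge> 0"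
        unfolding expand by (simp add: algebra_simps power2_eq_square)
      then show ?thesis
        using t by (simp add: zero_le_mult_iff)
    qed
    \<comment> \<open>The cap 1 keeps the point in \<open>C\<close>, and
      \<open>t * (Q + 1) \<le> - L\<close> gives \<open>2 * L + t * Q \<le> L - t < 0\<close>; the
      added 1 makes the denominator positive.\<close>
    define t where "t = min 1 (- L / (Q + 1))"
    have "0 < t" "t \<le> 1"
      using neg Q by (simp_all add: t_def divide_neg_pos)
    moreover have "t * (Q + 1) \<le> - L"
      using Q by (simp add: t_def pos_le_divide_eq[symmetric])
    ultimately show False
      using ineq[of t] neg by (simp add: algebra_simps)
  qed
  then show thesis
    using that[OF x(1)] by blast
qed

text \<open>The quadratic minimizer is optimal for weights \<open>\<bar>q i\<bar>\<close> with signs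
  opposite to \<open>q\<close>. A subgradient of any other test function has the same signs and
  weights monotone in these, so \<open>maximizer_transfer\<close> and the subgradient inequality
  yield the claim.\<close>

lemma least_weakly_abs_majorized_if_simultaneously_maximizing:
  fixes C :: "(real ^ 'n::finite) set"
  assumes C: "compact C" "convex C" and max: "simultaneously_maximizing C" and a: "\<And>i. a $ i > 0"
  obtains x where "least_weakly_abs_majorized a b C x"
proof -
  obtain x where x: "x \<in> C"
    "\<And>y. y \<in> C \<Longrightarrow> (\<Sum>i\<in>UNIV. (x $ i + b $ i) / a $ i * (y $ i - x $ i)) \<ge> 0"
    using least_quadratic_variational_inequality[OF C simultaneously_maximizing_nonempty[OF max] a]
    by blast
  define q where "q i = (x $ i + b $ i) / a $ i" for i
  define s :: "real ^ 'n" where "s = (\<chi> i. if q i \<ge> 0 then -1 else 1)"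
  have s: "s $ i \<in> {-1, 1}" for i
    by (simp add: s_def)
  have x_max: "(\<Sum>i\<in>UNIV. \<bar>q i\<bar> * (s $ i * y $ i)) \<le> (\<Sum>i\<in>UNIV. \<bar>q i\<bar> * (s $ i * x $ i))"
    if "y \<in> C" for y
  proof -
    have "(\<Sum>i\<in>UNIV. q i * (y $ i - x $ i))
        = (\<Sum>i\<in>UNIV. \<bar>q i\<bar> * (s $ i * x $ i) - \<bar>q i\<bar> * (s $ i * y $ i))"
      by (intro sum.cong) (auto simp: s_def algebra_simps)
    then show ?thesis
      using x(2)[OF that] by (simp add: q_def[symmetric] sum_subtractf)
  qed
  have "weakly_abs_majorized a b x y" if y: "y \<in> C" for y
    unfolding weakly_abs_majorized_def
  proof (intro allI impI, elim conjE)
    fix \<phi> :: "real \<Rightarrow> real"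
    assume even: "\<forall>t. \<phi> (- t) = \<phi> t" and convex: "convex_on UNIV \<phi>"
    obtain G where G: "G 0 = 0" "\<And>p r. 0 \<le> p \<Longrightarrow> p \<le> r \<Longrightarrow> G p \<le> G r"
      "\<And>q t. \<phi> t \<ge> \<phi> q + sgn q * G \<bar>q\<bar> * (t - q)"
      using obtain_even_subgradient[OF convex] even by blast
    have le: "(\<Sum>i\<in>UNIV. G \<bar>q i\<bar> * (s $ i * y $ i)) \<le> (\<Sum>i\<in>UNIV. G \<bar>q i\<bar> * (s $ i * x $ i))"
    proof (rule maximizer_transfer[where g = "\<lambda>i. \<bar>q i\<bar>", OF max s _ x(1) x_max _ _ _ y])
      show "0 \<le> G \<bar>q i\<bar>" for i
        using G(1) G(2)[of 0 "\<bar>q i\<bar>"] by simp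
    qed (simp_all add: G)
    have "(\<Sum>i\<in>UNIV. a $ i * \<phi> ((x $ i + b $ i) / a $ i))
        \<le> (\<Sum>i\<in>UNIV. a $ i * \<phi> ((x $ i + b $ i) / a $ i))
          + ((\<Sum>i\<in>UNIV. G \<bar>q i\<bar> * (s $ i * x $ i)) - (\<Sum>i\<in>UNIV. G \<bar>q i\<bar> * (s $ i * y $ i)))"
      using le by simp
    also have "\<dots> = (\<Sum>i\<in>UNIV. a $ i * (\<phi> (q i)
        + sgn (q i) * G \<bar>q i\<bar> * ((y $ i + b $ i) / a $ i - q i)))"
      unfolding sum_subtractf[symmetric] sum.distrib[symmetric]
    proof (rule sum.cong[OF refl])
      fix i
      \<comment> \<open>Where \<open>q i = 0\<close>, the signs differ but \<open>G\<close>
        vanishes.\<close>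
      have "sgn (q i) * G \<bar>q i\<bar> = - s $ i * G \<bar>q i\<bar>"
        using G(1) by (auto simp: s_def sgn_if)
      moreover have "a $ i * ((y $ i + b $ i) / a $ i - q i) = y $ i - x $ i"
        using a[of i] by (simp add: q_def field_simps)
      then have "a $ i * (\<phi> (q i) + (- s $ i * G \<bar>q i\<bar>) * ((y $ i + b $ i) / a $ i - q i))
          = a $ i * \<phi> (q i) + (- s $ i * G \<bar>q i\<bar>) * (y $ i - x $ i)"
        by (metis distrib_left mult.left_commute)
      ultimately show "a $ i * \<phi> ((x $ i + b $ i) / a $ i)
          + (G \<bar>q i\<bar> * (s $ i * x $ i) - G \<bar>q i\<bar> * (s $ i * y $ i))
          = a $ i * (\<phi> (q i) + sgn (q i) * G \<bar>q i\<bar> * ((y $ i + b $ i) / a $ i - q i))"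
        by (simp add: q_def algebra_simps)
    qed
    also have "\<dots> \<le> (\<Sum>i\<in>UNIV. a $ i * \<phi> ((y $ i + b $ i) / a $ i))"
      using G(3) a by (intro sum_mono mult_left_mono) (auto intro: less_imp_le)
    finally show "(\<Sum>i\<in>UNIV. a $ i * \<phi> ((x $ i + b $ i) / a $ i))
        \<le> (\<Sum>i\<in>UNIV. a $ i * \<phi> ((y $ i + b $ i) / a $ i))" .
  qed
  then show thesis
    using that x(1) by (auto simp: least_weakly_abs_majorized_def)
qed

subsection \<open>Excess functions\<close>

text \<open>The functions \<open>t \<mapsto> max (\<bar>t\<bar> - c) 0\<close> with \<open>c \<ge> 0\<close> are test functions common to weak absolute
  majorization and to monotonically even Schur-convexity, and they already suffice to recover
  all the other properties.\<close>

definition excess :: "real \<Rightarrow> real ^ 'n::finite \<Rightarrow> real" where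
  "excess c x = (\<Sum>i\<in>UNIV. max (x $ i - c) 0)"

definition abs_vec :: "real ^ 'n::finite \<Rightarrow> real ^ 'n" where
  "abs_vec x = (\<chi> i. \<bar>x $ i\<bar>)"

definition least_excess :: "real ^ 'n::finite \<Rightarrow> (real ^ 'n) set \<Rightarrow> real ^ 'n \<Rightarrow> bool" where
  "least_excess b C x \<longleftrightarrow>
    x \<in> C \<and> (\<forall>y\<in>C. \<forall>c\<ge>0. excess c (abs_vec (x + b)) \<le> excess c (abs_vec (y + b)))"

lemma least_excess_if_least_weakly_abs_majorized:
  fixes C :: "(real ^ 'n::finite) set"
  assumes "least_weakly_abs_majorized (\<chi> i. 1) b C x"
  shows "least_excess b C x"
proof -
  have x: "x \<in> C" "\<And>y. y \<in> C \<Longrightarrow> weakly_abs_majorized (\<chi> i. 1) b x y"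
    using assms by (auto simp: least_weakly_abs_majorized_def)
  have "excess c (abs_vec (x + b)) \<le> excess c (abs_vec (y + b))" if y: "y \<in> C" for y c
  proof -
    let ?\<phi> = "\<lambda>t :: real. max (\<bar>t\<bar> - c) 0"
    have "convex_on UNIV ?\<phi>"
    proof (rule convex_onI)
      fix t u v :: real
      assume t: "0 < t" "t < 1"
      have "\<bar>(1 - t) * u + t * v\<bar> \<le> (1 - t) * \<bar>u\<bar> + t * \<bar>v\<bar>"
        using t abs_triangle_ineq[of "(1 - t) * u" "t * v"] by (simp add: abs_mult)
      moreover have "(1 - t) * (\<bar>u\<bar> - c) \<le> (1 - t) * ?\<phi> u" "t * (\<bar>v\<bar> - c) \<le> t * ?\<phi> v"
        using t by (intro mult_left_mono; simp)+
      moreover have "0 \<le> (1 - t) * ?\<phi> u" "0 \<le> t * ?\<phi> v"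
        using t by auto
      moreover have "(1 - t) * (\<bar>u\<bar> - c) + t * (\<bar>v\<bar> - c) = (1 - t) * \<bar>u\<bar> + t * \<bar>v\<bar> - c"
        by (simp add: algebra_simps)
      ultimately show "?\<phi> ((1 - t) *\<^sub>R u + t *\<^sub>R v) \<le> (1 - t) * ?\<phi> u + t * ?\<phi> v"
        unfolding real_scaleR_def by (intro max.boundedI) linarith+
    qed simp
    moreover have "continuous_on UNIV ?\<phi>"
      by (intro continuous_intros)
    moreover have "\<forall>t. ?\<phi> (- t) = ?\<phi> t"
      by simp
    ultimately show ?thesis
      using x(2)[OF y] unfolding weakly_abs_majorized_def excess_def abs_vec_def
      by (auto dest!: spec[of _ ?\<phi>])
  qed
  with x(1) show ?thesis
    by (simp add: least_excess_def)
qed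

text \<open>Translating by widely separated magnitudes makes the largest \<open>k\<close> entries of \<open>\<bar>x + b\<bar>\<close> the
  first \<open>k\<close> entries along \<open>\<pi>\<close>, so a suitable excess is a constant minus the prefix sum.\<close>

lemma simultaneously_maximizing_if_least_excess:
  fixes C :: "(real ^ 'n::finite) set"
  assumes C: "compact C" and least: "\<And>b. \<exists>x. least_excess b C x"
  shows "simultaneously_maximizing C"
  unfolding simultaneously_maximizing_def
proof (intro allI impI)
  fix \<pi> :: "nat \<Rightarrow> 'n" and s
  assume \<pi>: "signed_enumeration \<pi> s"
  let ?n = "CARD('n)"
  have bij: "bij_betw \<pi> {1..?n} UNIV" and s: "\<And>i. s $ i = 1 \<or> s $ i = -1"
    using \<pi> by (auto simp: signed_enumeration_def)
  obtain R where R: "R > 0" "\<And>x. x \<in> C \<Longrightarrow> norm x \<le> R"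
    using compact_imp_bounded[OF C] by (auto simp: bounded_pos)
  \<comment> \<open>Entry \<open>i\<close> of the shifted absolute vector stays within
    \<open>R\<close> of \<open>M i\<close>. The spacing \<open>3 * R\<close> leaves room for a
    threshold between positions \<open>k\<close> and \<open>k + 1\<close>, and the last value
    \<open>3 * R\<close> still exceeds \<open>R\<close>, so the shift alone fixes every
    sign.\<close>
  define M where "M i = 3 * R * (real ?n + 1 - real i)" for i
  define b :: "real ^ 'n" where
    "b = (\<chi> j. - s $ j * M (the_inv_into {1..?n} \<pi> j))"
  have excess_eq: "excess (3 * R * (real ?n - real k) + R) (abs_vec (x + b))
      = (\<Sum>i=1..k. M i - (3 * R * (real ?n - real k) + R)) - prefix_sum \<pi> s k x"
    if x: "x \<in> C" and k: "k \<in> {1..?n}" for x k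
  proof -
    let ?c = "3 * R * (real ?n - real k) + R"
    have entry: "max (abs_vec (x + b) $ \<pi> i - ?c) 0
        = (if i \<le> k then M i - ?c - s $ \<pi> i * x $ \<pi> i else 0)" if i: "i \<in> {1..?n}" for i
    proof -
      have bi: "b $ \<pi> i = - s $ \<pi> i * M i"
        using the_inv_into_f_f[OF bij_betw_imp_inj_on[OF bij] i] by (simp add: b_def)
      have xi: "\<bar>x $ \<pi> i\<bar> \<le> R"
        using R(2)[OF x] component_le_norm_cart[of x "\<pi> i"] by linarith
      have "M i \<ge> 3 * R * 1"
        unfolding M_def using i R(1) by (intro mult_left_mono) auto
      then have abs: "abs_vec (x + b) $ \<pi> i = M i - s $ \<pi> i * x $ \<pi> i"
        using s[of "\<pi> i"] xi bi R(1) by (auto simp: abs_vec_def)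
      show ?thesis
      proof (cases "i \<le> k")
        case True
        have "M i \<ge> 3 * R * (real ?n - real k + 1)"
          unfolding M_def using True R(1) by (intro mult_left_mono) auto
        then show ?thesis
          using True s[of "\<pi> i"] xi R(1) unfolding abs by (auto simp: algebra_simps)
      next
        case False
        have "M i \<le> 3 * R * (real ?n - real k)"
          unfolding M_def using False R(1) by (intro mult_left_mono) auto
        then show ?thesis
          using False s[of "\<pi> i"] xi R(1) unfolding abs by auto
      qed
    qed
    have "excess ?c (abs_vec (x + b)) = (\<Sum>i=1..?n. max (abs_vec (x + b) $ \<pi> i - ?c) 0)"
      unfolding excess_def
      using sum.reindex_bij_betw[OF bij, of "\<lambda>j. max (abs_vec (x + b) $ j - ?c) 0"] by simp
    also have "\<dots> = (\<Sum>i=1..?n. if i \<le> k then M i - ?c - s $ \<pi> i * x $ \<pi> i else 0)"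
      by (intro sum.cong refl entry)
    also have "\<dots> = (\<Sum>i=1..k. M i - ?c - s $ \<pi> i * x $ \<pi> i)"
      using k by (intro sum.mono_neutral_cong_right) auto
    finally show ?thesis
      unfolding prefix_sum_def sum_subtractf[symmetric] .
  qed
  obtain x' where x': "x' \<in> C"
    "\<And>y c. y \<in> C \<Longrightarrow> c \<ge> 0 \<Longrightarrow> excess c (abs_vec (x' + b)) \<le> excess c (abs_vec (y + b))"
    using least[of b] by (auto simp: least_excess_def)
  have "prefix_sum \<pi> s k y \<le> prefix_sum \<pi> s k x'" if "y \<in> C" "k \<in> {1..?n}" for y k
  proof -
    have "3 * R * (real ?n - real k) + R \<ge> 0"
      using that(2) R(1) by simp
    from x'(2)[OF that(1) this] show ?thesis
      unfolding excess_eq[OF that] excess_eq[OF x'(1) that(2)] by simp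
  qed
  then show "\<exists>x'\<in>C. \<forall>x\<in>C. \<forall>k\<in>{1..?n}. prefix_sum \<pi> s k x \<le> prefix_sum \<pi> s k x'"
    using x'(1) by blast
qed

subsection \<open>Majorization and excesses\<close>

text \<open>Positions start at 0 here, matching the list indices of
  \<open>decr_rearrangement\<close>.\<close>

definition sorts :: "(nat \<Rightarrow> 'n::finite) \<Rightarrow> real ^ 'n \<Rightarrow> bool" where
  "sorts \<sigma> x \<longleftrightarrow> bij_betw \<sigma> {..<CARD('n)} UNIV
    \<and> (\<forall>i j. i \<le> j \<longrightarrow> j < CARD('n) \<longrightarrow> x $ \<sigma> j \<le> x $ \<sigma> i)"

lemma obtain_sorts:
  fixes x :: "real ^ 'n::finite"
  obtains \<sigma> where "sorts \<sigma> x"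
  using obtain_decreasing_enumeration[of "\<lambda>i. x $ i"] unfolding sorts_def by blast

lemma sorts_sum:
  fixes x :: "real ^ 'n::finite"
  assumes "sorts \<sigma> x"
  shows "(\<Sum>i\<in>UNIV. f i) = (\<Sum>k<CARD('n). f (\<sigma> k))"
  using assms sum.reindex_bij_betw[of \<sigma> "{..<CARD('n)}" UNIV f] by (simp add: sorts_def)

lemma decr_rearrangement_eq:
  fixes x :: "real ^ 'n::finite"
  assumes \<sigma>: "sorts \<sigma> x"
  shows "decr_rearrangement x = map (\<lambda>k. x $ \<sigma> k) [0..<CARD('n)]"
proof -
  let ?xs = "map (\<lambda>k. x $ \<sigma> k) [0..<CARD('n)]"
  have bij: "bij_betw \<sigma> {0..<CARD('n)} UNIV"
    using \<sigma> by (simp add: sorts_def atLeast0LessThan)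
  have "mset_set UNIV = image_mset \<sigma> (mset_set {0..<CARD('n)})"
    using image_mset_mset_set[OF bij_betw_imp_inj_on[OF bij]] bij by (simp add: bij_betw_def)
  then have "image_mset (\<lambda>i. x $ i) (mset_set UNIV) = mset ?xs"
    by (simp add: image_mset.compositionality comp_def)
  moreover have "sort ?xs = rev ?xs"
  proof (rule properties_for_sort)
    show "sorted (rev ?xs)"
      using \<sigma> by (auto simp: sorted_rev_iff_nth_mono sorts_def)
  qed simp
  ultimately have "sorted_list_of_multiset (image_mset (\<lambda>i. x $ i) (mset_set UNIV)) = rev ?xs"
    by (simp only: sorted_list_of_multiset_mset)
  then show ?thesis
    by (simp add: decr_rearrangement_def)
qed

lemma decr_rearrangement_sum:
  fixes x :: "real ^ 'n::finite"
  assumes "sorts \<sigma> x" "k \<le> CARD('n)"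
  shows "(\<Sum>i<k. decr_rearrangement x ! i) = (\<Sum>i<k. x $ \<sigma> i)"
  unfolding decr_rearrangement_eq[OF assms(1)] using assms(2) by (intro sum.cong) auto

lemma majorized_iff:
  fixes x y :: "real ^ 'n::finite"
  assumes "sorts \<sigma> x" "sorts \<tau> y"
  shows "majorized x y \<longleftrightarrow> (\<forall>k\<le>CARD('n). (\<Sum>i<k. x $ \<sigma> i) \<le> (\<Sum>i<k. y $ \<tau> i))
    \<and> (\<Sum>i\<in>UNIV. x $ i) = (\<Sum>i\<in>UNIV. y $ i)"
proof -
  have "(\<forall>k\<in>{1..CARD('n)}. (\<Sum>i<k. x $ \<sigma> i) \<le> (\<Sum>i<k. y $ \<tau> i))
      \<longleftrightarrow> (\<forall>k\<le>CARD('n). (\<Sum>i<k. x $ \<sigma> i) \<le> (\<Sum>i<k. y $ \<tau> i))"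
    (is "?L \<longleftrightarrow> ?R")
  proof
    assume L: ?L
    show ?R
    proof (intro allI impI)
      fix k assume "k \<le> CARD('n)"
      then show "(\<Sum>i<k. x $ \<sigma> i) \<le> (\<Sum>i<k. y $ \<tau> i)"
        using L by (cases "k = 0") auto
    qed
  qed auto
  then show ?thesis
    using assms by (simp add: majorized_def vsum_def decr_rearrangement_sum)
qed

text \<open>An excess is the largest of these sums over \<open>k\<close>;
  \<open>excess_eq_top_sum\<close> identifies where the maximum is attained.\<close>

lemma top_sum_le_excess:
  fixes x :: "real ^ 'n::finite"
  assumes \<sigma>: "sorts \<sigma> x" and k: "k \<le> CARD('n)"
  shows "(\<Sum>i<k. x $ \<sigma> i - c) \<le> excess c x"
proof -
  have "(\<Sum>i<k. x $ \<sigma> i - c) \<le> (\<Sum>i<k. max (x $ \<sigma> i - c) 0)"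
    by (intro sum_mono) auto
  also have "\<dots> \<le> (\<Sum>i<CARD('n). max (x $ \<sigma> i - c) 0)"
    using k by (intro sum_mono2) auto
  finally show ?thesis
    by (simp add: excess_def sorts_sum[OF \<sigma>])
qed

lemma excess_eq_top_sum:
  fixes x :: "real ^ 'n::finite"
  assumes \<sigma>: "sorts \<sigma> x" and k: "k \<le> CARD('n)"
    and above: "\<And>i. i < k \<Longrightarrow> c \<le> x $ \<sigma> i"
    and below: "\<And>i. k \<le> i \<Longrightarrow> i < CARD('n) \<Longrightarrow> x $ \<sigma> i \<le> c"
  shows "excess c x = (\<Sum>i<k. x $ \<sigma> i - c)"
  unfolding excess_def sorts_sum[OF \<sigma>]
  by (intro sum.mono_neutral_cong_right) (use k above below in \<open>auto simp: not_less\<close>)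

lemma majorized_excess_le:
  fixes x y :: "real ^ 'n::finite"
  assumes "majorized x y"
  shows "excess c x \<le> excess c y"
proof -
  obtain \<sigma> \<tau> where \<sigma>: "sorts \<sigma> x" and \<tau>: "sorts \<tau> y"
    using obtain_sorts by metis
  \<comment> \<open>\<open>k\<close> counts the entries of \<open>x\<close> greater than
    \<open>c\<close>; the alternative \<open>CARD('n)\<close> covers the case that all of them
    are.\<close>
  define k where "k = (LEAST k. k = CARD('n) \<or> x $ \<sigma> k \<le> c)"
  have k: "k = CARD('n) \<or> x $ \<sigma> k \<le> c"
    unfolding k_def by (rule LeastI[of _ "CARD('n)"]) simp
  have k_le: "k \<le> CARD('n)"
    unfolding k_def by (rule Least_le) simp
  have "excess c x = (\<Sum>i<k. x $ \<sigma> i - c)"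
  proof (rule excess_eq_top_sum[OF \<sigma> k_le])
    show "c \<le> x $ \<sigma> i" if "i < k" for i
      using not_less_Least[of i "\<lambda>k. k = CARD('n) \<or> x $ \<sigma> k \<le> c"] that
      unfolding k_def by auto
    show "x $ \<sigma> i \<le> c" if "k \<le> i" "i < CARD('n)" for i
    proof -
      have "x $ \<sigma> i \<le> x $ \<sigma> k"
        using \<sigma> that by (simp add: sorts_def)
      then show ?thesis
        using k that by auto
    qed
  qed
  also have "\<dots> \<le> (\<Sum>i<k. y $ \<tau> i - c)"
    using assms k_le unfolding majorized_iff[OF \<sigma> \<tau>] by (simp add: sum_subtractf)
  also have "\<dots> \<le> excess c y"
    by (rule top_sum_le_excess[OF \<tau> k_le])
  finally show ?thesis .
qed

text \<open>For nonnegative \<open>c\<close>, the excess of an absolute value splits into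
  \<open>max (t - c) 0 + max (- t - c) 0\<close>, and the second term equals
  \<open>max (t + c) 0 - (t + c)\<close>. Majorization controls both excesses and fixes the
  total.\<close>

lemma excess_abs_vec:
  fixes x :: "real ^ 'n::finite"
  assumes "c \<ge> 0"
  shows "excess c (abs_vec x) = excess c x + excess (- c) x - (\<Sum>i\<in>UNIV. x $ i + c)"
  unfolding excess_def abs_vec_def sum.distrib[symmetric] sum_subtractf[symmetric]
  using assms by (intro sum.cong) (auto simp: max_def)

lemma schur_convex_excess_abs_vec:
  assumes "c \<ge> 0"
  shows "schur_convex (\<lambda>x :: real ^ 'n::finite. excess c (abs_vec x))"
  unfolding schur_convex_def
proof (intro allI impI)
  fix x y :: "real ^ 'n"
  assume "majorized x y"
  moreover from this have "(\<Sum>i\<in>UNIV. x $ i + c) = (\<Sum>i\<in>UNIV. y $ i + c)"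
    by (simp add: majorized_def vsum_def sum.distrib)
  ultimately show "excess c (abs_vec x) \<le> excess c (abs_vec y)"
    unfolding excess_abs_vec[OF assms]
    using majorized_excess_le[of x y c] majorized_excess_le[of x y "- c"] by simp
qed

lemma monotonically_even_excess_abs_vec:
  "monotonically_even (\<lambda>x :: real ^ 'n::finite. excess c (abs_vec x))"
proof -
  have mono: "excess c (abs_vec x) \<le> excess c (abs_vec (replace_entry x i t))"
    if "\<bar>x $ i\<bar> \<le> \<bar>t\<bar>" for x :: "real ^ 'n" and i t
    unfolding excess_def abs_vec_def replace_entry_def
    using that by (intro sum_mono) auto
  have "abs_vec (replace_entry x i (- (x $ i))) = abs_vec x" for x :: "real ^ 'n" and i
    by (simp add: abs_vec_def replace_entry_def vec_eq_iff)
  then show ?thesis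
    unfolding monotonically_even_def by (auto intro!: mono)
qed

lemma continuous_on_excess_abs_vec:
  "continuous_on S (\<lambda>x :: real ^ 'n::finite. excess c (abs_vec x))"
  unfolding excess_def abs_vec_def vec_lambda_beta by (intro continuous_intros)

section \<open>Monotonically even functions and weak majorization\<close>

text \<open>Entries are replaced one at a time. If the new value has the opposite sign, move to its
  negative first and then flip.\<close>

lemma monotonically_even_mono:
  fixes x y :: "real ^ 'n::finite"
  assumes \<Phi>: "monotonically_even \<Phi>" and le: "\<And>i. \<bar>x $ i\<bar> \<le> \<bar>y $ i\<bar>"
  shows "\<Phi> x \<le> \<Phi> y"
proof -
  have flip: "\<Phi> (replace_entry z i (- (z $ i))) = \<Phi> z"
    and down: "\<epsilon> > 0 \<Longrightarrow> z $ i \<le> 0 \<Longrightarrow> \<Phi> z \<le> \<Phi> (replace_entry z i (z $ i - \<epsilon>))"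
    and up: "\<epsilon> > 0 \<Longrightarrow> z $ i \<ge> 0 \<Longrightarrow> \<Phi> z \<le> \<Phi> (replace_entry z i (z $ i + \<epsilon>))" for z i \<epsilon>
    using \<Phi> by (auto simp: monotonically_even_def)
  have self: "replace_entry z i (z $ i) = z" for z :: "real ^ 'n" and i
    by (simp add: replace_entry_def vec_eq_iff)
  have twice: "replace_entry (replace_entry z i t) i t' = replace_entry z i t'"
    and entry: "replace_entry z i t $ i = t" for z :: "real ^ 'n" and i t t'
    by (simp_all add: replace_entry_def vec_eq_iff)
  have same_sign: "\<Phi> z \<le> \<Phi> (replace_entry z i t)"
    if "\<bar>z $ i\<bar> \<le> \<bar>t\<bar>" "z $ i \<ge> 0 \<and> t \<ge> 0 \<or> z $ i \<le> 0 \<and> t \<le> 0" for z i t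
    using up[of "t - z $ i" z i] down[of "z $ i - t" z i] that self[of z i]
    by (cases "t = z $ i") auto
  have single: "\<Phi> z \<le> \<Phi> (replace_entry z i t)" if "\<bar>z $ i\<bar> \<le> \<bar>t\<bar>" for z i t
  proof (cases "z $ i \<ge> 0 \<and> t \<ge> 0 \<or> z $ i \<le> 0 \<and> t \<le> 0")
    case True
    then show ?thesis
      using same_sign that by blast
  next
    case False
    then have "\<Phi> z \<le> \<Phi> (replace_entry z i (- t))"
      using that by (intro same_sign) auto
    then show ?thesis
      using flip[of "replace_entry z i (- t)" i] by (simp add: twice entry)
  qed
  define mix where "mix A = (\<chi> i. if i \<in> A then y $ i else x $ i)" for A
  have "\<Phi> x \<le> \<Phi> (mix A)" if "finite A" for A
    using that
  proof (induction A)
    case empty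
    have "mix {} = x"
      by (simp add: mix_def vec_eq_iff)
    then show ?case by simp
  next
    case (insert j A)
    have "mix (insert j A) = replace_entry (mix A) j (y $ j)"
      by (auto simp: mix_def replace_entry_def vec_eq_iff)
    moreover have "\<bar>mix A $ j\<bar> \<le> \<bar>y $ j\<bar>"
      using insert.hyps le by (simp add: mix_def)
    ultimately show ?case
      using insert.IH single[of "mix A" j "y $ j"] by simp
  qed
  from this[of UNIV] show ?thesis
    by (simp add: mix_def)
qed

text \<open>Weak majorization factors as \<open>u \<prec> w \<le> v\<close>: in decreasing order, \<open>w\<close> has the partial sums of
  \<open>v\<close> capped at the total of \<open>u\<close>. Keeping the partial sums below this cap rather
  than decreasing the last entry preserves nonnegativity.\<close>

lemma weak_majorization_factorization:
  fixes u v :: "real ^ 'n::finite"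
  assumes u: "\<And>i. u $ i \<ge> 0" and v: "\<And>i. v $ i \<ge> 0"
    and excess: "\<And>c. c \<ge> 0 \<Longrightarrow> excess c u \<le> excess c v"
  obtains w where "majorized u w" "\<And>i. 0 \<le> w $ i" "\<And>i. w $ i \<le> v $ i"
proof -
  let ?n = "CARD('n)"
  obtain \<sigma> \<tau> where \<sigma>: "sorts \<sigma> u" and \<tau>: "sorts \<tau> v"
    using obtain_sorts by metis
  define U V W where "U k = (\<Sum>i<k. u $ \<sigma> i)" and "V k = (\<Sum>i<k. v $ \<tau> i)"
    and "W k = min (V k) (U ?n)" for k
  have UV: "U k \<le> V k" if k: "k \<le> ?n" for k
  proof (cases k)
    case 0
    then show ?thesis by (simp add: U_def V_def)
  next
    case (Suc m)
    \<comment> \<open>At the \<open>k\<close>-th largest entry of \<open>v\<close> as threshold, the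
      excess of \<open>v\<close> is exactly its shifted top sum, while that of \<open>u\<close> is
      at least its own.\<close>
    let ?c = "v $ \<tau> m"
    have "excess ?c v = (\<Sum>i<k. v $ \<tau> i - ?c)"
      by (rule excess_eq_top_sum[OF \<tau> k]) (use \<tau> k Suc in \<open>auto simp: sorts_def\<close>)
    moreover have "(\<Sum>i<k. u $ \<sigma> i - ?c) \<le> excess ?c u"
      by (rule top_sum_le_excess[OF \<sigma> k])
    ultimately show ?thesis
      using excess[of ?c] v by (simp add: U_def V_def sum_subtractf)
  qed
  have U_mono: "U k \<le> U l" if "k \<le> l" for k l
    unfolding U_def using that u by (intro sum_mono2) auto
  have V_mono: "V k \<le> V l" if "k \<le> l" for k l
    unfolding V_def using that v by (intro sum_mono2) auto
  have V_Suc: "V (Suc k) = V k + v $ \<tau> k" for k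
    by (simp add: V_def)
  have step: "0 \<le> W (Suc k) - W k" "W (Suc k) - W k \<le> v $ \<tau> k" for k
    using v[of "\<tau> k"] by (auto simp: W_def V_Suc min_def)
  \<comment> \<open>The increments of \<open>W\<close> follow those of \<open>V\<close> until the
    cap, then at most one is partial and the rest are 0. Hence \<open>w\<close> is sorted by the
    same \<open>\<tau>\<close>.\<close>
  have concave: "W (Suc j) - W j \<le> W (Suc i) - W i" if ij: "i \<le> j" "j < ?n" for i j
  proof (cases "i = j")
    case False
    then have "V (Suc i) \<le> V j" "V j \<le> V (Suc j)" "V i \<le> V (Suc i)"
      using ij by (auto intro!: V_mono)
    moreover have "v $ \<tau> j \<le> v $ \<tau> i"
      using \<tau> ij by (simp add: sorts_def)
    ultimately show ?thesis
      using step(1)[of i] step(2)[of j] unfolding W_def min_def V_Suc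
      by (auto split: if_splits)
  qed simp
  define w :: "real ^ 'n" where
    "w = (\<chi> j. let k = the_inv_into {..<?n} \<tau> j in W (Suc k) - W k)"
  have bij: "bij_betw \<tau> {..<?n} UNIV"
    using \<tau> by (simp add: sorts_def)
  have w: "w $ \<tau> k = W (Suc k) - W k" if "k < ?n" for k
    using the_inv_into_f_f[OF bij_betw_imp_inj_on[OF bij]] that by (simp add: w_def)
  have sorts_w: "sorts \<tau> w"
    using bij concave w by (simp add: sorts_def)
  have W0: "W 0 = 0"
    using U_mono[of 0 ?n] by (simp add: W_def V_def U_def)
  have w_sum: "(\<Sum>i<k. w $ \<tau> i) = W k" if "k \<le> ?n" for k
  proof -
    have "(\<Sum>i<k. w $ \<tau> i) = (\<Sum>i<k. W (Suc i) - W i)"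
      using that w by (intro sum.cong) auto
    then show ?thesis
      by (simp add: sum_lessThan_telescope W0)
  qed
  have "majorized u w"
    unfolding majorized_iff[OF \<sigma> sorts_w]
  proof (intro conjI allI impI)
    show "(\<Sum>i<k. u $ \<sigma> i) \<le> (\<Sum>i<k. w $ \<tau> i)" if "k \<le> ?n" for k
      using UV[OF that] U_mono[OF that] by (simp add: w_sum[OF that] W_def U_def)
    show "(\<Sum>i\<in>UNIV. u $ i) = (\<Sum>i\<in>UNIV. w $ i)"
      using UV[of ?n] w_sum[of ?n]
      by (simp add: sorts_sum[OF \<sigma>, of "\<lambda>i. u $ i"] sorts_sum[OF \<tau>, of "\<lambda>i. w $ i"] W_def U_def)
  qed
  moreover have "0 \<le> w $ i \<and> w $ i \<le> v $ i" for i
  proof -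
    obtain k where "k < ?n" "i = \<tau> k"
      using bij unfolding bij_betw_def by (metis UNIV_I imageE lessThan_iff)
    then show ?thesis
      using step w by simp
  qed
  ultimately show thesis
    using that by blast
qed

text \<open>Pass to absolute values by evenness, apply Schur-convexity up to the intermediate
  \<open>w\<close>, then entrywise monotonicity up to \<open>y + b\<close>.\<close>

lemma least_excess_minimizes:
  fixes C :: "(real ^ 'n::finite) set"
  assumes least: "least_excess b C x" and \<Phi>: "schur_convex \<Phi>" "monotonically_even \<Phi>"
    and y: "y \<in> C"
  shows "\<Phi> (x + b) \<le> \<Phi> (y + b)"
proof -
  obtain w where w: "majorized (abs_vec (x + b)) w" "\<And>i. 0 \<le> w $ i"
    "\<And>i. w $ i \<le> abs_vec (y + b) $ i"
    using weak_majorization_factorization[of "abs_vec (x + b)" "abs_vec (y + b)"] least y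
    by (auto simp: abs_vec_def least_excess_def)
  have "\<Phi> (x + b) \<le> \<Phi> (abs_vec (x + b))"
    by (rule monotonically_even_mono[OF \<Phi>(2)]) (simp add: abs_vec_def)
  also have "\<dots> \<le> \<Phi> w"
    using \<Phi>(1) w(1) by (simp add: schur_convex_def)
  also have "\<dots> \<le> \<Phi> (y + b)"
    by (rule monotonically_even_mono[OF \<Phi>(2)]) (use w(2,3) in \<open>simp add: abs_vec_def\<close>)
  finally show ?thesis .
qed

section \<open>Assembling the equivalences\<close>

theorem theorem7:
  fixes C :: "(real ^ 'n::finite) set"
  assumes "compact C" and "convex C"
  shows "all_equivalent
    [ \<forall>a b :: real ^ 'n. (\<forall>i. a $ i > 0) \<longrightarrow> (\<exists>x. least_weakly_abs_majorized a b C x),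
      \<forall>b :: real ^ 'n. \<exists>x. least_weakly_abs_majorized (\<chi> i. 1) b C x,
      \<forall>b :: real ^ 'n. \<exists>x'\<in>C. \<forall>\<Phi> :: real ^ 'n \<Rightarrow> real.
        schur_convex \<Phi> \<and> monotonically_even \<Phi> \<and> continuous_on UNIV \<Phi> \<longrightarrow>
        (\<forall>x\<in>C. \<Phi> (x' + b) \<le> \<Phi> (x + b)),
      \<forall>(\<pi> :: nat \<Rightarrow> 'n) (s :: real ^ 'n).
        bij_betw \<pi> {1..CARD('n)} UNIV \<and> (\<forall>i. s $ i \<in> {-1, 1}) \<longrightarrow>
        (\<exists>x'\<in>C. \<forall>x\<in>C. \<forall>k\<in>{1..CARD('n)}.
           (\<Sum>i=1..k. s $ \<pi> i * x' $ \<pi> i) \<ge> (\<Sum>i=1..k. s $ \<pi> i * x $ \<pi> i)),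
      bisubmodular (max_diff C) \<and> C = bisubmodular_polyhedron (max_diff C) ]"
    (is "all_equivalent [?P1, ?P2, ?P3, ?P4, ?P5]")
proof -
  \<comment> \<open>\<open>?W\<close> is an auxiliary statement: it follows from (2), is equivalent
    to (3), and implies (4).\<close>
  let ?W = "\<forall>b. \<exists>x. least_excess b C x"
  have P4: "?P4 \<longleftrightarrow> simultaneously_maximizing C"
    unfolding simultaneously_maximizing_def signed_enumeration_def prefix_sum_def by blast
  have "?P1 \<Longrightarrow> ?P2"
    by simp
  moreover have "?P2 \<Longrightarrow> ?W"
    using least_excess_if_least_weakly_abs_majorized by blast
  moreover have "?W \<Longrightarrow> ?P3"
  proof (intro allI)
    fix b
    assume ?W
    then obtain x' where x': "least_excess b C x'"
      by blast
    then have "x' \<in> C"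
      by (simp add: least_excess_def)
    with least_excess_minimizes[OF x']
    show "\<exists>x'\<in>C. \<forall>\<Phi>. schur_convex \<Phi> \<and> monotonically_even \<Phi> \<and> continuous_on UNIV \<Phi> \<longrightarrow>
        (\<forall>x\<in>C. \<Phi> (x' + b) \<le> \<Phi> (x + b))"
      by blast
  qed
  moreover have "?P3 \<Longrightarrow> ?W"
  proof (intro allI)
    fix b
    assume ?P3
    then obtain x' where x': "x' \<in> C"
      "\<And>\<Phi> x. schur_convex \<Phi> \<Longrightarrow> monotonically_even \<Phi> \<Longrightarrow> continuous_on UNIV \<Phi> \<Longrightarrow> x \<in> C \<Longrightarrow>
        \<Phi> (x' + b) \<le> \<Phi> (x + b)"
      by metis
    have "excess c (abs_vec (x' + b)) \<le> excess c (abs_vec (x + b))" if "c \<ge> 0" "x \<in> C" for c x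
      using x'(2)[OF schur_convex_excess_abs_vec[OF that(1)] monotonically_even_excess_abs_vec
          continuous_on_excess_abs_vec that(2)] .
    with x'(1) show "\<exists>x. least_excess b C x"
      unfolding least_excess_def by blast
  qed
  moreover have "?W \<Longrightarrow> simultaneously_maximizing C"
    using simultaneously_maximizing_if_least_excess[OF assms(1)] by blast
  moreover have "simultaneously_maximizing C \<Longrightarrow> ?P1"
    using least_weakly_abs_majorized_if_simultaneously_maximizing[OF assms] by metis
  moreover have "simultaneously_maximizing C \<Longrightarrow> ?P5"
    using bisubmodular_max_diff[OF assms(1)] eq_bisubmodular_polyhedron[OF assms] by blast
  moreover have "?P5 \<Longrightarrow> simultaneously_maximizing C"
    using simultaneously_maximizing_if_bisubmodular[OF assms(1)] by blast
  ultimately have "?P1 \<longleftrightarrow> simultaneously_maximizing C" "?P2 \<longleftrightarrow> simultaneously_maximizing C"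
    "?P3 \<longleftrightarrow> simultaneously_maximizing C" "?P5 \<longleftrightarrow> simultaneously_maximizing C"
    by argo+
  with P4 show ?thesis
    unfolding all_equivalent_def by simp
qed

end
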